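(* Consider the problem of minimizing $f(x)=\sum_{i=1}^m f_i(x)$ over $x\in\mathbb{R}^d$, with $f_i:\mathbb{R}^d\to\mathbb{R}$. Assume that: (i) each $f_i$ is convex and has $L$-Lipschitz continuous gradient, i.e. $f_i(x)+\langle\nabla f_i(x),y-x\rangle\le f_i(y)\le f_i(x)+\langle\nabla f_i(x),y-x\rangle+\frac L2\|y-x\|^2$ for all $x,y\in\mathbb{R}^d$; (ii) each $f_i$ can be written as $f_i(x)=\ell(a_i^Tx,b_i)$ such that $\mathrm{supp}(\nabla f_i(x))=\mathrm{supp}(a_i)$, for given data $\{(a_i,b_i)\}_{i=1}^m$ with $a_i\in\mathbb{R}^d$, $b_i\in\mathbb{R}$. Let $\bar L=L\sqrt{m(1+\Delta)}$ and $\Delta=\min(\Delta_{\rm ave},\Delta_{\max})$. Let $Q$ be an unbiased random quantizer with parameter $\alpha$. Given $\varepsilon_0=\|x_0-x^\star\|^2$, by running $$x_{k+1}=x_k-\gamma_kQ(\nabla f(x_k))\qquad\text{with}\qquad\gamma_k=\frac{1}{\bar L\alpha}$$ for at most $$T^\star=\frac{\alpha\bar L}{2}\cdot\frac{\varepsilon_0}{\varepsilon}$$ iterations, under which $$B^\star=(\log_2d+B)\,c\cdot\frac{\alpha\bar L}{2}\cdot\frac{\varepsilon_0}{\varepsilon}$$ bits are sent, we ensure $\mathbf{E}(f(x_T)-f^\star)\le\varepsilon$. Here $B$ is the number of bits required to encode a single vector entry and $\mathbf{E}\{\|Q(v)\|_0\}\le c$.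
   Context: $\|\cdot\|$ is the Euclidean norm, $\|v\|_0$ is the number of nonzero entries of $v$, and $\mathrm{supp}(x)=\{i: x^i\ne0\}$, where $x^i$ is the $i$-th entry of $x$. $x^\star$ is a minimizer of $f$ and $f^\star=f(x^\star)$; $x_0\in\mathbb{R}^d$ is the initial point, $x_T$ is the iterate after $T$ iterations, and $\varepsilon>0$ is the target accuracy. Conflict graph degrees of the data: $\Delta_{\rm ave}=\frac1m\sum_{i=1}^m\sum_{j\ne i}\mathbf 1\{\mathrm{supp}(a_i)\cap\mathrm{supp}(a_j)\ne\emptyset\}$ and $\Delta_{\max}=\max_{i}\sum_{j\ne i}\mathbf 1\{\mathrm{supp}(a_i)\cap\mathrm{supp}(a_j)\ne\emptyset\}$. An unbiased random quantizer with parameter $\alpha$ (finite, positive) is a random mapping $Q:\mathbb{R}^d\to\mathbb{R}^d$ such that for every $v\in\mathbb{R}^d$: $\mathrm{supp}(Q(v))\subseteq\mathrm{supp}(v)$, $\mathbf{E}\{Q(v)\}=v$, and $\mathbf{E}\{\|Q(v)\|^2\}\le\alpha\|v\|^2$. The constant $c\le d$ is finite and positive, with $\mathbf{E}\{\|Q(v)\|_0\}\le c$ for any $v\in\mathbb{R}^d$. Each application of $Q$ uses fresh randomness. Bit count: a naive encoding of a vector processed by the quantizer is taken to require $c(\log_2d+B)$ bits, namely $\log_2d$ bits to represent each index and $B$ bits to represent the corresponding vector entry of $c$ nonzero values; one quantized vector is sent per iteration. *)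

theory Defs
  imports "HOL-Probability.Probability"
begin

definition supp :: "real ^ 'd \<Rightarrow> 'd set" where
  "supp v = {i. v $ i \<noteq> 0}"

definition nnz :: "real ^ 'd \<Rightarrow> nat" where
  "nnz v = card (supp v)"

text \<open>The gradient is meaningful only where the function is differentiable;
  differentiability is always assumed separately.\<close>

definition grad :: "('a::real_inner \<Rightarrow> real) \<Rightarrow> 'a \<Rightarrow> 'a" where
  "grad f x = (THE D. GDERIV f x :> D)"

text \<open>A convex function with \<open>L\<close>-Lipschitz gradient, expressed through the first-order
  lower and quadratic upper bounds.\<close>

definition convex_smooth :: "real \<Rightarrow> ('a::real_inner \<Rightarrow> real) \<Rightarrow> bool" where
  "convex_smooth L f \<longleftrightarrow>
     (\<forall>x. f differentiable (at x)) \<and>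
     (\<forall>x y. f x + grad f x \<bullet> (y - x) \<le> f y \<and>
            f y \<le> f x + grad f x \<bullet> (y - x) + L / 2 * (norm (y - x))\<^sup>2)"

definition conflict_degree :: "nat \<Rightarrow> (nat \<Rightarrow> real ^ 'd) \<Rightarrow> nat \<Rightarrow> real" where
  "conflict_degree m a i = (\<Sum>j\<in>{1..m} - {i}. of_bool (supp (a i) \<inter> supp (a j) \<noteq> {}))"

definition conflict_ave :: "nat \<Rightarrow> (nat \<Rightarrow> real ^ 'd) \<Rightarrow> real" where
  "conflict_ave m a = 1 / real m * (\<Sum>i=1..m. conflict_degree m a i)"

definition conflict_max :: "nat \<Rightarrow> (nat \<Rightarrow> real ^ 'd) \<Rightarrow> real" where
  "conflict_max m a = Max (conflict_degree m a ` {1..m})"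

text \<open>A random mapping is a jointly measurable function \<open>Q s v\<close> of a random seed \<open>s\<close>, whose
  law is the probability measure \<open>N\<close>, and of the vector \<open>v\<close>.  Integrability is explicit because
  the Bochner integral of a non-integrable function is 0.\<close>

definition unbiased_quantizer ::
    "'s measure \<Rightarrow> ('s \<Rightarrow> real ^ 'd \<Rightarrow> real ^ 'd) \<Rightarrow> real \<Rightarrow> bool" where
  "unbiased_quantizer N Q \<alpha> \<longleftrightarrow>
     prob_space N \<and> 0 < \<alpha> \<and>
     (\<lambda>(s, v). Q s v) \<in> borel_measurable (N \<Otimes>\<^sub>M borel) \<and>
     (\<forall>v. (AE s in N. supp (Q s v) \<subseteq> supp v) \<and>
          integrable N (\<lambda>s. Q s v) \<and>
          (\<integral>s. Q s v \<partial>N) = v \<and>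
          integrable N (\<lambda>s. (norm (Q s v))\<^sup>2) \<and>
          (\<integral>s. (norm (Q s v))\<^sup>2 \<partial>N) \<le> \<alpha> * (norm v)\<^sup>2)"

text \<open>Fresh randomness: the seeds used by the successive applications of the quantizer are
  independent, each with law \<open>N\<close>.\<close>

definition fresh_seeds :: "'w measure \<Rightarrow> 's measure \<Rightarrow> (nat \<Rightarrow> 'w \<Rightarrow> 's) \<Rightarrow> bool" where
  "fresh_seeds M N \<xi> \<longleftrightarrow>
     prob_space.indep_vars M (\<lambda>_. N) \<xi> UNIV \<and> (\<forall>k. distr M N (\<xi> k) = N)"

text \<open>Naive encoding of \<open>n\<close> nonzero entries in dimension \<open>d\<close>: an index of \<open>log\<^sub>2 d\<close> bits and a
  value of \<open>B\<close> bits for each.  The count \<open>n\<close> is real, as it may also be a bound on an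
  expected number of nonzero entries.\<close>

definition encoding_bits :: "nat \<Rightarrow> real \<Rightarrow> real \<Rightarrow> real" where
  "encoding_bits d B n = n * (log 2 (real d) + B)"

end

theory Submission
  imports Defs
begin

text \<open>Two independent facts carry the proof.

  The first is deterministic: the sum \<open>f\<close> is convex and \<open>Lbar\<close>-smooth with
  \<open>Lbar = L sqrt (m (1 + \<Delta>))\<close>, rather than just \<open>L m\<close>-smooth. A summand sees only the coordinates
  in the support of its data vector, so its quadratic upper bound needs only these coordinates,
  and the curvature of the sum in coordinate \<open>j\<close> is \<open>L\<close> times the number of summands that
  involve \<open>j\<close>. Those summands form a clique of the conflict graph, and a clique of size \<open>n\<close>
  satisfies \<open>n\<^sup>2 \<le> m (1 + \<Delta>)\<close> (\<open>coordinate_multiplicity_le\<close>, \<open>sparse_sum_convex_smooth\<close>).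

  The second is the analysis of stochastic gradient descent on a convex \<open>L\<close>-smooth function
  with step \<open>\<gamma> = 1 / (L \<alpha>)\<close>. With \<open>x\<^sub>k\<close> held fixed, averaging over the current seed gives both
  \<open>E \<parallel>x\<^sub>k\<^sub>+\<^sub>1 - xstar\<parallel>\<^sup>2 \<le> \<parallel>x\<^sub>k - xstar\<parallel>\<^sup>2 - 2 \<gamma> (f x\<^sub>k - f xstar)\<close> (\<open>quantized_step_distance\<close>) and
  \<open>E (f x\<^sub>k\<^sub>+\<^sub>1) \<le> f x\<^sub>k\<close> (\<open>quantized_step_descent\<close>). As \<open>x\<^sub>k\<close> depends on earlier seeds only, these
  bounds survive taking full expectations (\<open>fresh_seed_expectation_le\<close>). Telescoping the first and
  using the monotonicity from the second yields
  \<open>(t + 1) E (f x\<^sub>t - f xstar) \<le> \<alpha> L \<parallel>x\<^sub>0 - xstar\<parallel>\<^sup>2 / 2 = Tstar \<epsilon>\<close>.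
  The factor is \<open>t + 1\<close> and not \<open>t\<close>, so the accuracy is reached as soon as \<open>t + 1 > Tstar\<close>: the number
  of iterations may be \<open>Tstar\<close> rounded down, even when this is zero.

  The bit count is linear in the number of transmitted entries, whose expectation in each iteration
  is at most \<open>c\<close>, again by averaging over the current seed with the iterate held fixed.\<close>

section \<open>Gradients of smooth convex functions\<close>

lemma grad_eqI:
  fixes f :: "'a::real_inner \<Rightarrow> real"
  assumes "GDERIV f x :> D"
  shows "grad f x = D"
  unfolding grad_def
proof (rule the_equality[where P = "\<lambda>D. GDERIV f x :> D", OF assms])
  fix D' assume "GDERIV f x :> D'"
  then have "(\<lambda>h. h \<bullet> D') = (\<lambda>h. h \<bullet> D)"
    using assms has_derivative_unique unfolding gderiv_def by blast
  then have "(D' - D) \<bullet> D' = (D' - D) \<bullet> D"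
    by metis
  then show "D' = D"
    by (metis inner_diff_right inner_eq_zero_iff right_minus_eq)
qed

lemma GDERIV_grad:
  fixes f :: "'a::euclidean_space \<Rightarrow> real"
  assumes "f differentiable (at x)"
  shows "GDERIV f x :> grad f x"
proof -
  obtain f' where f': "(f has_derivative f') (at x)"
    using assms unfolding differentiable_def by blast
  then have "linear f'"
    by (rule has_derivative_linear)
  (* Riesz representation of the derivative. *)
  then have "f' = (\<lambda>h. h \<bullet> adjoint f' 1)"
    using adjoint_works[of f' _ 1] by (simp add: fun_eq_iff)
  with f' have "GDERIV f x :> adjoint f' 1"
    unfolding gderiv_def by simp
  with grad_eqI[OF this] show ?thesis
    by simp
qed

lemma grad_sum:
  fixes F :: "'i \<Rightarrow> 'a::euclidean_space \<Rightarrow> real"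
  assumes "\<And>i. i \<in> I \<Longrightarrow> F i differentiable (at x)"
  shows "grad (\<lambda>y. \<Sum>i\<in>I. F i y) x = (\<Sum>i\<in>I. grad (F i) x)"
proof (rule grad_eqI)
  show "GDERIV (\<lambda>y. \<Sum>i\<in>I. F i y) x :> (\<Sum>i\<in>I. grad (F i) x)"
    using GDERIV_grad[OF assms] unfolding gderiv_def inner_sum_right
    by (intro has_derivative_sum)
qed

text \<open>Let \<open>z\<close> be one gradient step from \<open>y\<close> for the function \<open>f - \<langle>grad f x, \<cdot>\<rangle>\<close>, which is
  minimal at \<open>x\<close>. The quadratic upper bound at \<open>y\<close> and the linear lower bound at \<open>x\<close>, both
  evaluated at \<open>z\<close>, squeeze out the extra square.\<close>

lemma convex_smooth_lower_bound:
  assumes f: "convex_smooth L f" and "0 < L"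
  shows "f x + grad f x \<bullet> (y - x) + (norm (grad f y - grad f x))\<^sup>2 / (2 * L) \<le> f y"
proof -
  define d where "d = grad f y - grad f x"
  define z where "z = y - (1 / L) *\<^sub>R d"
  have "f x + grad f x \<bullet> (z - x) \<le> f z"
    and "f z \<le> f y + grad f y \<bullet> (z - y) + L / 2 * (norm (z - y))\<^sup>2"
    using f unfolding convex_smooth_def by blast+
  moreover have "grad f x \<bullet> (z - x) = grad f x \<bullet> (y - x) - (1 / L) * (grad f x \<bullet> d)"
    by (simp add: z_def inner_diff_right algebra_simps)
  moreover have "grad f y \<bullet> (z - y) = - (1 / L) * (grad f x \<bullet> d) - (1 / L) * (norm d)\<^sup>2"
    by (simp add: z_def d_def power2_norm_eq_inner inner_diff_left algebra_simps)
  moreover have "L / 2 * (norm (z - y))\<^sup>2 = (1 / (2 * L)) * (norm d)\<^sup>2"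
    using \<open>0 < L\<close> by (simp add: z_def power_mult_distrib power2_eq_square)
  moreover have "(1 / L) * (norm d)\<^sup>2 - (1 / (2 * L)) * (norm d)\<^sup>2 = (norm d)\<^sup>2 / (2 * L)"
    using \<open>0 < L\<close> by (simp add: field_simps)
  ultimately show ?thesis
    unfolding d_def[symmetric] by linarith
qed

lemma convex_smooth_grad_lipschitz:
  assumes "convex_smooth L f" and "0 < L"
  shows "norm (grad f y - grad f x) \<le> L * norm (y - x)"
proof -
  define d where "d = grad f y - grad f x"
  have "(norm d)\<^sup>2 / (2 * L) + (norm d)\<^sup>2 / (2 * L) \<le> d \<bullet> (y - x)"
    using convex_smooth_lower_bound[OF assms, of x y] convex_smooth_lower_bound[OF assms, of y x]
    unfolding d_def norm_minus_commute[of "grad f x"] by (simp add: inner_diff algebra_simps)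
  also have "\<dots> \<le> norm d * norm (y - x)"
    by (rule norm_cauchy_schwarz)
  finally have "norm d * norm d \<le> norm d * (L * norm (y - x))"
    using \<open>0 < L\<close> by (simp add: field_simps power2_eq_square)
  then show ?thesis
    unfolding d_def[symmetric] using \<open>0 < L\<close>
    by (cases "norm d = 0") (auto simp: mult_le_cancel_left)
qed

lemma convex_smooth_continuous_grad:
  assumes "convex_smooth L f" and "0 < L"
  shows "continuous_on UNIV (grad f)"
proof -
  have "L-lipschitz_on UNIV (grad f)"
    using convex_smooth_grad_lipschitz[OF assms] \<open>0 < L\<close>
    by (intro lipschitz_onI) (auto simp: dist_norm)
  then show ?thesis
    by (rule lipschitz_on_continuous_on)
qed

lemma convex_smooth_continuous:
  assumes "convex_smooth L f"
  shows "continuous_on UNIV f"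
  using assms unfolding convex_smooth_def
  by (simp add: continuous_at_imp_continuous_on differentiable_imp_continuous_within)

lemma convex_smooth_grad_minimizer:
  assumes f: "convex_smooth L f" and "0 < L" and min: "\<And>y. f xstar \<le> f y"
  shows "grad f xstar = 0"
proof -
  define g where "g = grad f xstar"
  define z where "z = xstar - (1 / L) *\<^sub>R g"
  have "f xstar \<le> f z"
    by (rule min)
  also have "\<dots> \<le> f xstar + g \<bullet> (z - xstar) + L / 2 * (norm (z - xstar))\<^sup>2"
    using f unfolding g_def convex_smooth_def by blast
  also have "\<dots> = f xstar - (norm g)\<^sup>2 / (2 * L)"
    using \<open>0 < L\<close>
    by (simp add: z_def power_mult_distrib power2_norm_eq_inner[symmetric] power2_eq_square field_simps)
  finally have "(norm g)\<^sup>2 \<le> 0"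
    using \<open>0 < L\<close> by (simp add: field_simps)
  then show ?thesis
    by (simp add: g_def)
qed

section \<open>Smoothness of a sum with sparse conflicts\<close>

lemma conflict_degree_nonneg: "0 \<le> conflict_degree m a i"
  unfolding conflict_degree_def by (intro sum_nonneg) simp

lemma conflict_ave_nonneg: "0 \<le> conflict_ave m a"
  unfolding conflict_ave_def by (simp add: sum_nonneg conflict_degree_nonneg)

lemma conflict_max_nonneg:
  assumes "1 \<le> m"
  shows "0 \<le> conflict_max m a"
  unfolding conflict_max_def using assms conflict_degree_nonneg[of m a 1]
  by (subst Max_ge_iff) auto

text \<open>All summands whose data involve the coordinate \<open>j\<close> are in conflict with one another.
  So each of these \<open>n\<close> summands has degree at least \<open>n - 1\<close>: hence \<open>n \<le> 1 + \<Delta>\<^sub>m\<^sub>a\<^sub>x\<close>, and summing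
  over the clique gives \<open>n\<^sup>2 \<le> m (1 + \<Delta>\<^sub>a\<^sub>v\<^sub>e)\<close>.\<close>

lemma coordinate_multiplicity_le:
  fixes a :: "nat \<Rightarrow> real ^ 'd"
  assumes "1 \<le> m"
  shows "real (card {i \<in> {1..m}. j \<in> supp (a i)})
           \<le> sqrt (real m * (1 + min (conflict_ave m a) (conflict_max m a)))"
proof -
  define I where "I = {i \<in> {1..m}. j \<in> supp (a i)}"
  have I: "I \<subseteq> {1..m}" "finite I"
    by (auto simp: I_def)
  have deg: "real (card I) \<le> 1 + conflict_degree m a i" if "i \<in> I" for i
  proof -
    have "real (card (I - {i})) = (\<Sum>l\<in>I - {i}. 1)"
      by simp
    also have "\<dots> = (\<Sum>l\<in>I - {i}. of_bool (supp (a i) \<inter> supp (a l) \<noteq> {}))"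
      using that by (intro sum.cong) (auto simp: I_def)
    also have "\<dots> \<le> conflict_degree m a i"
      unfolding conflict_degree_def using I by (intro sum_mono2) auto
    finally show ?thesis
      using that I(2) by (simp add: card_Diff_singleton of_nat_diff)
  qed
  have "card I \<le> m"
    using card_mono[OF _ I(1)] by simp
  moreover have "real (card I) \<le> 1 + conflict_max m a"
  proof (cases "I = {}")
    case True
    then show ?thesis using conflict_max_nonneg[OF \<open>1 \<le> m\<close>, of a] by simp
  next
    case False
    then obtain i where "i \<in> I" by blast
    then have "conflict_degree m a i \<le> conflict_max m a"
      unfolding conflict_max_def using I(1) by (intro Max_ge) auto
    with deg[OF \<open>i \<in> I\<close>] show ?thesis by simp
  qed
  ultimately have by_max: "(real (card I))\<^sup>2 \<le> real m * (1 + conflict_max m a)"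
    unfolding power2_eq_square by (intro mult_mono) auto
  have "(real (card I))\<^sup>2 = (\<Sum>i\<in>I. real (card I))"
    by (simp add: power2_eq_square)
  also have "\<dots> \<le> (\<Sum>i\<in>I. 1 + conflict_degree m a i)"
    by (intro sum_mono deg)
  also have "\<dots> \<le> (\<Sum>i=1..m. 1 + conflict_degree m a i)"
    using I by (intro sum_mono2 add_nonneg_nonneg conflict_degree_nonneg) auto
  also have "\<dots> = real m * (1 + conflict_ave m a)"
    using \<open>1 \<le> m\<close> by (simp add: sum.distrib conflict_ave_def field_simps)
  finally have "(real (card I))\<^sup>2 \<le> real m * (1 + conflict_ave m a)" .
  with by_max show ?thesis
    unfolding I_def[symmetric] by (intro real_le_rsqrt) (auto simp: min_def)
qed

lemma power2_norm_vec: "(norm v)\<^sup>2 = (\<Sum>j\<in>UNIV. (v $ j)\<^sup>2)"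
  for v :: "real ^ 'd"
  unfolding power2_norm_eq_inner inner_vec_def by (simp add: power2_eq_square)

text \<open>Both the value and the gradient of the function see only the coordinates in \<open>S\<close>, so \<open>y\<close> may
  be replaced by the point that agrees with \<open>y\<close> on \<open>S\<close> and with \<open>x\<close> elsewhere.\<close>

lemma smooth_upper_bound_on_support:
  fixes F :: "real ^ 'd \<Rightarrow> real"
  assumes F: "convex_smooth L F" and supp: "supp (grad F x) \<subseteq> S"
    and local: "\<And>y z. (\<And>j. j \<in> S \<Longrightarrow> y $ j = z $ j) \<Longrightarrow> F y = F z"
  shows "F y \<le> F x + grad F x \<bullet> (y - x) + L / 2 * (\<Sum>j\<in>S. ((y - x) $ j)\<^sup>2)"
proof -
  define z where "z = (\<chi> j. if j \<in> S then y $ j else x $ j)"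
  have "F y = F z"
    by (rule local) (simp add: z_def)
  also have "\<dots> \<le> F x + grad F x \<bullet> (z - x) + L / 2 * (norm (z - x))\<^sup>2"
    using F unfolding convex_smooth_def by blast
  also have "grad F x \<bullet> (z - x) = grad F x \<bullet> (y - x)"
    unfolding inner_vec_def using supp
    by (intro sum.cong) (auto simp: z_def supp_def)
  also have "(norm (z - x))\<^sup>2 = (\<Sum>j\<in>UNIV. ((z - x) $ j)\<^sup>2)"
    by (rule power2_norm_vec)
  also have "\<dots> = (\<Sum>j\<in>S. ((y - x) $ j)\<^sup>2)"
    by (intro sum.mono_neutral_cong_right) (auto simp: z_def)
  finally show ?thesis .
qed

text \<open>In the sum of the quadratic upper bounds, the square of coordinate \<open>j\<close> occurs once for every
  summand whose data involve \<open>j\<close>. The multiplicity bound then replaces the trivial constant \<open>L m\<close>.\<close>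

lemma sparse_sum_convex_smooth:
  fixes F :: "nat \<Rightarrow> real ^ 'd \<Rightarrow> real"
  assumes "1 \<le> m" and "0 < L"
    and smooth: "\<And>i. i \<in> {1..m} \<Longrightarrow> convex_smooth L (F i)"
    and supp: "\<And>i y. i \<in> {1..m} \<Longrightarrow> supp (grad (F i) y) \<subseteq> supp (a i)"
    and data: "\<And>i y. i \<in> {1..m} \<Longrightarrow> F i y = loss i (a i \<bullet> y)"
  shows "convex_smooth (L * sqrt (real m * (1 + min (conflict_ave m a) (conflict_max m a))))
           (\<lambda>y. \<Sum>i=1..m. F i y)"
proof -
  define n where "n j = card {i \<in> {1..m}. j \<in> supp (a i)}" for j
  define R where "R = sqrt (real m * (1 + min (conflict_ave m a) (conflict_max m a)))"
  have n_le: "real (n j) \<le> R" for j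
    unfolding n_def R_def by (rule coordinate_multiplicity_le[OF \<open>1 \<le> m\<close>])
  have diff: "F i differentiable (at x)" if "i \<in> {1..m}" for i x
    using smooth[OF that] unfolding convex_smooth_def by blast
  have grad: "grad (\<lambda>y. \<Sum>i=1..m. F i y) x = (\<Sum>i=1..m. grad (F i) x)" for x
    by (rule grad_sum) (rule diff)
  have lower: "(\<Sum>i=1..m. F i x) + (\<Sum>i=1..m. grad (F i) x) \<bullet> (y - x) \<le> (\<Sum>i=1..m. F i y)" for x y
    unfolding inner_sum_left sum.distrib[symmetric]
    using smooth unfolding convex_smooth_def by (intro sum_mono) blast
  have local: "F i y = F i z"
    if i: "i \<in> {1..m}" and eq: "\<And>j. j \<in> supp (a i) \<Longrightarrow> y $ j = z $ j" for i y z
  proof -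
    have "a i \<bullet> y = a i \<bullet> z"
      unfolding inner_vec_def using eq
      by (intro sum.cong) (auto simp: supp_def)
    then show ?thesis using data[OF i] by simp
  qed
  have upper: "(\<Sum>i=1..m. F i y) \<le> (\<Sum>i=1..m. F i x) + (\<Sum>i=1..m. grad (F i) x) \<bullet> (y - x)
                  + L * R / 2 * (norm (y - x))\<^sup>2" for x y
  proof -
    let ?q = "\<lambda>j. ((y - x) $ j)\<^sup>2"
    have "(\<Sum>i=1..m. F i y) \<le> (\<Sum>i=1..m. F i x + grad (F i) x \<bullet> (y - x) + L / 2 * (\<Sum>j\<in>supp (a i). ?q j))"
      by (intro sum_mono smooth_upper_bound_on_support smooth supp) (auto intro: local)
    also have "\<dots> = (\<Sum>i=1..m. F i x) + (\<Sum>i=1..m. grad (F i) x) \<bullet> (y - x)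
                     + L / 2 * (\<Sum>i=1..m. \<Sum>j\<in>supp (a i). ?q j)"
      by (simp add: sum.distrib inner_sum_left sum_distrib_left)
    also have "(\<Sum>i=1..m. \<Sum>j\<in>supp (a i). ?q j) = (\<Sum>i=1..m. \<Sum>j\<in>{j \<in> UNIV. j \<in> supp (a i)}. ?q j)"
      by simp
    also have "\<dots> = (\<Sum>j\<in>UNIV. \<Sum>i\<in>{i \<in> {1..m}. j \<in> supp (a i)}. ?q j)"
      by (rule sum.swap_restrict) auto
    also have "\<dots> = (\<Sum>j\<in>UNIV. real (n j) * ?q j)"
      by (simp add: n_def)
    also have "\<dots> \<le> (\<Sum>j\<in>UNIV. R * ?q j)"
      by (intro sum_mono mult_right_mono n_le) simp
    also have "\<dots> = R * (norm (y - x))\<^sup>2"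
      by (simp only: power2_norm_vec sum_distrib_left)
    finally show ?thesis
      using \<open>0 < L\<close> by simp
  qed
  show ?thesis
    unfolding convex_smooth_def R_def[symmetric] grad
    using lower upper diff by (auto intro!: differentiable_sum)
qed

section \<open>One quantized gradient step\<close>

text \<open>Unbiasedness turns the cross term into \<open>\<langle>grad f v, v - xstar\<rangle>\<close>, which the strengthened
  convexity bound at the minimizer estimates from below by the suboptimality plus a multiple of the
  squared gradient. The step size is chosen so that this multiple cancels the second moment of
  the quantizer exactly.\<close>

lemma quantized_step_distance:
  fixes f :: "real ^ 'd \<Rightarrow> real"
  assumes f: "convex_smooth L f" and "0 < L" and min: "\<And>y. f xstar \<le> f y"
    and Q: "unbiased_quantizer N Q \<alpha>" and \<gamma>: "\<gamma> = 1 / (L * \<alpha>)"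
  shows "integrable N (\<lambda>s. (norm (v - \<gamma> *\<^sub>R Q s (grad f v) - xstar))\<^sup>2)"
    and "(\<integral>s. (norm (v - \<gamma> *\<^sub>R Q s (grad f v) - xstar))\<^sup>2 \<partial>N)
           \<le> (norm (v - xstar))\<^sup>2 - 2 * \<gamma> * (f v - f xstar)"
proof -
  interpret N: prob_space N
    using Q unfolding unbiased_quantizer_def by blast
  define g where "g = grad f v"
  have \<alpha>: "0 < \<alpha>" and int1: "integrable N (\<lambda>s. Q s g)" and mean: "(\<integral>s. Q s g \<partial>N) = g"
    and int2: "integrable N (\<lambda>s. (norm (Q s g))\<^sup>2)"
    and var: "(\<integral>s. (norm (Q s g))\<^sup>2 \<partial>N) \<le> \<alpha> * (norm g)\<^sup>2"
    using Q unfolding unbiased_quantizer_def by blast+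
  have expand: "(norm (v - \<gamma> *\<^sub>R Q s g - xstar))\<^sup>2
      = (norm (v - xstar))\<^sup>2 - 2 * \<gamma> * (Q s g \<bullet> (v - xstar)) + \<gamma>\<^sup>2 * (norm (Q s g))\<^sup>2" for s
    unfolding power2_norm_eq_inner
    by (simp add: inner_diff_left inner_diff_right inner_commute algebra_simps power2_eq_square)
  show "integrable N (\<lambda>s. (norm (v - \<gamma> *\<^sub>R Q s (grad f v) - xstar))\<^sup>2)"
    unfolding g_def[symmetric] expand using int1 int2 by simp
  have "(\<integral>s. (norm (v - \<gamma> *\<^sub>R Q s g - xstar))\<^sup>2 \<partial>N)
      = (norm (v - xstar))\<^sup>2 - 2 * \<gamma> * (g \<bullet> (v - xstar)) + \<gamma>\<^sup>2 * (\<integral>s. (norm (Q s g))\<^sup>2 \<partial>N)"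
    unfolding expand using int1 int2 mean by (simp add: N.prob_space)
  also have "\<dots> \<le> (norm (v - xstar))\<^sup>2 - 2 * \<gamma> * (g \<bullet> (v - xstar)) + \<gamma>\<^sup>2 * (\<alpha> * (norm g)\<^sup>2)"
    using var by (simp add: mult_left_mono)
  also have "\<gamma>\<^sup>2 * (\<alpha> * (norm g)\<^sup>2) = 2 * \<gamma> * ((norm g)\<^sup>2 / (2 * L))"
    using \<alpha> \<open>0 < L\<close> by (simp add: \<gamma> power2_eq_square)
  also have "(norm (v - xstar))\<^sup>2 - 2 * \<gamma> * (g \<bullet> (v - xstar)) + 2 * \<gamma> * ((norm g)\<^sup>2 / (2 * L))
      = (norm (v - xstar))\<^sup>2 - 2 * \<gamma> * (g \<bullet> (v - xstar) - (norm g)\<^sup>2 / (2 * L))"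
    by (simp add: algebra_simps)
  also have "\<dots> \<le> (norm (v - xstar))\<^sup>2 - 2 * \<gamma> * (f v - f xstar)"
  proof -
    have "f v - f xstar \<le> g \<bullet> (v - xstar) - (norm g)\<^sup>2 / (2 * L)"
      using convex_smooth_lower_bound[OF f \<open>0 < L\<close>, of v xstar]
        convex_smooth_grad_minimizer[OF f \<open>0 < L\<close> min]
      by (simp add: g_def inner_diff_right)
    moreover have "0 \<le> 2 * \<gamma>"
      using \<alpha> \<open>0 < L\<close> by (simp add: \<gamma>)
    ultimately show ?thesis
      by (simp add: mult_left_mono)
  qed
  finally show "(\<integral>s. (norm (v - \<gamma> *\<^sub>R Q s (grad f v) - xstar))\<^sup>2 \<partial>N)
           \<le> (norm (v - xstar))\<^sup>2 - 2 * \<gamma> * (f v - f xstar)"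
    unfolding g_def .
qed

text \<open>The second moment of the quantizer costs only half of the first-order decrease
  \<open>\<gamma> \<parallel>grad f v\<parallel>\<^sup>2\<close>, so the objective does not increase in expectation.\<close>

lemma quantized_step_descent:
  fixes f :: "real ^ 'd \<Rightarrow> real"
  assumes f: "convex_smooth L f" and "0 < L" and min: "\<And>y. f xstar \<le> f y"
    and Q: "unbiased_quantizer N Q \<alpha>" and \<gamma>: "\<gamma> = 1 / (L * \<alpha>)"
  shows "integrable N (\<lambda>s. f (v - \<gamma> *\<^sub>R Q s (grad f v)) - f xstar)"
    and "(\<integral>s. f (v - \<gamma> *\<^sub>R Q s (grad f v)) - f xstar \<partial>N) \<le> f v - f xstar"
proof -
  interpret N: prob_space N
    using Q unfolding unbiased_quantizer_def by blast
  define g where "g = grad f v"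
  have \<alpha>: "0 < \<alpha>" and int1: "integrable N (\<lambda>s. Q s g)" and mean: "(\<integral>s. Q s g \<partial>N) = g"
    and int2: "integrable N (\<lambda>s. (norm (Q s g))\<^sup>2)"
    and var: "(\<integral>s. (norm (Q s g))\<^sup>2 \<partial>N) \<le> \<alpha> * (norm g)\<^sup>2"
    using Q unfolding unbiased_quantizer_def by blast+
  have [measurable]: "f \<in> borel_measurable borel"
    using convex_smooth_continuous[OF f] by (rule borel_measurable_continuous_onI)
  have [measurable]: "(\<lambda>s. Q s g) \<in> borel_measurable N"
    using int1 by (rule borel_measurable_integrable)
  define U where "U s = f v - f xstar - \<gamma> * (Q s g \<bullet> g) + L / 2 * \<gamma>\<^sup>2 * (norm (Q s g))\<^sup>2" for s
  have bound: "f (v - \<gamma> *\<^sub>R Q s g) - f xstar \<le> U s" for s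
  proof -
    have "f (v - \<gamma> *\<^sub>R Q s g) \<le> f v + g \<bullet> (v - \<gamma> *\<^sub>R Q s g - v)
        + L / 2 * (norm (v - \<gamma> *\<^sub>R Q s g - v))\<^sup>2"
      using f unfolding convex_smooth_def g_def by blast
    then show ?thesis
      by (simp add: U_def power_mult_distrib inner_commute)
  qed
  have U: "integrable N U"
    unfolding U_def using int1 int2 by simp
  show int: "integrable N (\<lambda>s. f (v - \<gamma> *\<^sub>R Q s (grad f v)) - f xstar)"
    unfolding g_def[symmetric]
  proof (rule Bochner_Integration.integrable_bound[OF U])
    show "AE s in N. norm (f (v - \<gamma> *\<^sub>R Q s g) - f xstar) \<le> norm (U s)"
      using bound min by (intro AE_I2) (smt (verit) real_norm_def)
  qed simp
  have "(\<integral>s. f (v - \<gamma> *\<^sub>R Q s g) - f xstar \<partial>N) \<le> (\<integral>s. U s \<partial>N)"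
    using int U bound unfolding g_def[symmetric] by (intro integral_mono)
  also have "\<dots> = f v - f xstar - \<gamma> * (norm g)\<^sup>2 + L / 2 * \<gamma>\<^sup>2 * (\<integral>s. (norm (Q s g))\<^sup>2 \<partial>N)"
    unfolding U_def using int1 int2 mean by (simp add: N.prob_space power2_norm_eq_inner)
  also have "\<dots> \<le> f v - f xstar - \<gamma> * (norm g)\<^sup>2 + L / 2 * \<gamma>\<^sup>2 * (\<alpha> * (norm g)\<^sup>2)"
    using var \<open>0 < L\<close> by (simp add: mult_left_mono)
  also have "L / 2 * \<gamma>\<^sup>2 * (\<alpha> * (norm g)\<^sup>2) = \<gamma> / 2 * (norm g)\<^sup>2"
    using \<alpha> \<open>0 < L\<close> by (simp add: \<gamma> power2_eq_square)
  also have "f v - f xstar - \<gamma> * (norm g)\<^sup>2 + \<gamma> / 2 * (norm g)\<^sup>2 \<le> f v - f xstar"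
    using \<alpha> \<open>0 < L\<close> by (simp add: \<gamma> field_simps)
  finally show "(\<integral>s. f (v - \<gamma> *\<^sub>R Q s (grad f v)) - f xstar \<partial>N) \<le> f v - f xstar"
    unfolding g_def .
qed

section \<open>Recursions driven by fresh seeds\<close>

text \<open>The recursion as a function of the whole seed sequence, so that the dependence of the
  \<open>k\<close>-th iterate on the first \<open>k\<close> seeds alone can be expressed.\<close>

primrec seeded_iterate :: "('s \<Rightarrow> 'v \<Rightarrow> 'v) \<Rightarrow> 'v \<Rightarrow> nat \<Rightarrow> (nat \<Rightarrow> 's) \<Rightarrow> 'v" where
  "seeded_iterate h v0 0 s = v0"
| "seeded_iterate h v0 (Suc k) s = h (s k) (seeded_iterate h v0 k s)"

lemma seeded_iterate_cong:
  assumes "\<And>i. i < k \<Longrightarrow> s i = s' i"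
  shows "seeded_iterate h v0 k s = seeded_iterate h v0 k s'"
  using assms by (induction k) auto

lemma seeded_iterate_measurable:
  assumes h: "(\<lambda>(s, v). h s v) \<in> measurable (N \<Otimes>\<^sub>M R) R" and "v0 \<in> space R"
    and "{..<k} \<subseteq> A"
  shows "seeded_iterate h v0 k \<in> measurable (PiM A (\<lambda>_. N)) R"
  using assms(3)
proof (induction k)
  case 0
  then show ?case using \<open>v0 \<in> space R\<close> by simp
next
  case (Suc k)
  then have "k \<in> A" and sub: "{..<k} \<subseteq> A" by auto
  then have "(\<lambda>s. (s k, seeded_iterate h v0 k s)) \<in> measurable (PiM A (\<lambda>_. N)) (N \<Otimes>\<^sub>M R)"
    using Suc.IH[OF sub] by (intro measurable_Pair measurable_component_singleton)
  from measurable_comp[OF this h] show ?case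
    by (simp add: comp_def)
qed

text \<open>The \<open>k\<close>-th iterate is a function of earlier seeds, hence independent of the \<open>k\<close>-th
  seed: their joint law is a product and Tonelli's theorem lets the current seed be averaged first,
  with the iterate held fixed. Nonnegativity makes integrability part of the conclusion.\<close>

lemma fresh_seed_expectation_le:
  fixes \<phi> :: "'s \<Rightarrow> 'v \<Rightarrow> real" and K :: "'v \<Rightarrow> real"
  assumes "prob_space M" and fresh: "fresh_seeds M N \<xi>"
    and h: "(\<lambda>(s, v). h s v) \<in> measurable (N \<Otimes>\<^sub>M R) R" and v0: "v0 \<in> space R"
    and init: "\<And>\<omega>. \<omega> \<in> space M \<Longrightarrow> x 0 \<omega> = v0"
    and step: "\<And>k \<omega>. \<omega> \<in> space M \<Longrightarrow> x (Suc k) \<omega> = h (\<xi> k \<omega>) (x k \<omega>)"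
    and \<phi>: "(\<lambda>(s, v). \<phi> s v) \<in> borel_measurable (N \<Otimes>\<^sub>M R)" and nonneg: "\<And>s v. 0 \<le> \<phi> s v"
    and int: "\<And>v. v \<in> space R \<Longrightarrow> integrable N (\<lambda>s. \<phi> s v)"
    and le: "\<And>v. v \<in> space R \<Longrightarrow> (\<integral>s. \<phi> s v \<partial>N) \<le> K v"
    and K: "integrable M (\<lambda>\<omega>. K (x k \<omega>))"
  shows "integrable M (\<lambda>\<omega>. \<phi> (\<xi> k \<omega>) (x k \<omega>))"
    and "(\<integral>\<omega>. \<phi> (\<xi> k \<omega>) (x k \<omega>) \<partial>M) \<le> (\<integral>\<omega>. K (x k \<omega>) \<partial>M)"
proof -
  interpret M: prob_space M by fact
  (* Both blocks live in a product space over nat, so that independence of disjoint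
     families of seeds applies to them; the current seed is component k of the second one. *)
  define past where "past \<omega> = (\<lambda>i\<in>{..<k}. \<xi> i \<omega>)" for \<omega>
  define now where "now \<omega> = (\<lambda>i\<in>{k}. \<xi> i \<omega>)" for \<omega>
  define P where "P = PiM {..<k} (\<lambda>_. N)"
  define S where "S = PiM {k} (\<lambda>_. N)"
  define H where "H = seeded_iterate h v0 k"
  have ind: "M.indep_vars (\<lambda>_. N) \<xi> UNIV" and law: "distr M N (\<xi> k) = N"
    using fresh unfolding fresh_seeds_def by auto
  have \<xi>[measurable]: "\<xi> k \<in> measurable M N"
    using ind unfolding M.indep_vars_def by auto
  have "M.indep_var P past S now"
    unfolding P_def S_def past_def now_def by (rule M.indep_var_restrict[OF ind]) auto
  then have past[measurable]: "past \<in> measurable M P" and now[measurable]: "now \<in> measurable M S"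
    and joint: "distr M (P \<Otimes>\<^sub>M S) (\<lambda>\<omega>. (past \<omega>, now \<omega>)) = distr M P past \<Otimes>\<^sub>M distr M S now"
    unfolding M.indep_var_distribution_eq by auto
  have H[measurable]: "H \<in> measurable P R"
    unfolding H_def P_def by (rule seeded_iterate_measurable[OF h v0]) simp
  have [measurable]: "(\<lambda>q. q k) \<in> measurable S N"
    unfolding S_def by (rule measurable_component_singleton) simp
  have now_k: "now \<omega> k = \<xi> k \<omega>" for \<omega>
    by (simp add: now_def)
  have "x j \<omega> = seeded_iterate h v0 j (\<lambda>i. \<xi> i \<omega>)" if "\<omega> \<in> space M" for j \<omega>
    using that by (induction j) (simp_all add: init step)
  moreover have "H (past \<omega>) = seeded_iterate h v0 k (\<lambda>i. \<xi> i \<omega>)" for \<omega>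
    unfolding H_def by (rule seeded_iterate_cong) (simp add: past_def)
  ultimately have x: "x k \<omega> = H (past \<omega>)" if "\<omega> \<in> space M" for \<omega>
    using that by simp
  have x_space: "x k \<omega> \<in> space R" if "\<omega> \<in> space M" for \<omega>
    using measurable_space[OF H measurable_space[OF past that]] x[OF that] by simp
  have x_meas[measurable]: "x k \<in> measurable M R"
    using measurable_compose[OF past H] x by (simp cong: measurable_cong)
  have \<phi>x: "(\<lambda>\<omega>. \<phi> (\<xi> k \<omega>) (x k \<omega>)) \<in> borel_measurable M"
    using measurable_compose[OF measurable_Pair[OF \<xi> x_meas] \<phi>] by simp
  define \<Phi> where "\<Phi> = (\<lambda>(p, q). ennreal (\<phi> (q k) (H p)))"
  have [measurable]: "\<Phi> \<in> borel_measurable (P \<Otimes>\<^sub>M S)"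
  proof -
    have "(\<lambda>z. (snd z k, H (fst z))) \<in> measurable (P \<Otimes>\<^sub>M S) (N \<Otimes>\<^sub>M R)"
      by measurable
    from measurable_compose[OF this \<phi>] show ?thesis
      unfolding \<Phi>_def by (simp add: case_prod_beta)
  qed
  interpret S: prob_space "distr M S now"
    by (rule M.prob_space_distr) simp
  have "(\<integral>\<^sup>+\<omega>. ennreal (\<phi> (\<xi> k \<omega>) (x k \<omega>)) \<partial>M) = (\<integral>\<^sup>+\<omega>. \<Phi> (past \<omega>, now \<omega>) \<partial>M)"
    by (intro nn_integral_cong) (simp add: \<Phi>_def x now_k)
  also have "\<dots> = (\<integral>\<^sup>+z. \<Phi> z \<partial>(distr M P past \<Otimes>\<^sub>M distr M S now))"
    unfolding joint[symmetric] by (subst nn_integral_distr) auto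
  also have "\<dots> = (\<integral>\<^sup>+p. \<integral>\<^sup>+q. \<Phi> (p, q) \<partial>distr M S now \<partial>distr M P past)"
    by (subst S.nn_integral_fst) (auto cong: measurable_cong_sets)
  also have "\<dots> = (\<integral>\<^sup>+p. \<integral>\<^sup>+\<omega>'. \<Phi> (p, now \<omega>') \<partial>M \<partial>distr M P past)"
    by (intro nn_integral_cong nn_integral_distr) (auto simp: space_pair_measure)
  also have "\<dots> = (\<integral>\<^sup>+\<omega>. \<integral>\<^sup>+\<omega>'. \<Phi> (past \<omega>, now \<omega>') \<partial>M \<partial>M)"
    by (intro nn_integral_distr) auto
  also have "\<dots> \<le> (\<integral>\<^sup>+\<omega>. ennreal (K (x k \<omega>)) \<partial>M)"
  proof (rule nn_integral_mono)
    fix \<omega> assume \<omega>: "\<omega> \<in> space M"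
    have meas: "(\<lambda>s. \<phi> s (x k \<omega>)) \<in> borel_measurable N"
      using int[OF x_space[OF \<omega>]] by (rule borel_measurable_integrable)
    have "(\<integral>\<^sup>+\<omega>'. \<Phi> (past \<omega>, now \<omega>') \<partial>M) = (\<integral>\<^sup>+\<omega>'. ennreal (\<phi> (\<xi> k \<omega>') (x k \<omega>)) \<partial>M)"
      by (simp add: \<Phi>_def now_k x[OF \<omega>])
    also have "\<dots> = (\<integral>\<^sup>+s. ennreal (\<phi> s (x k \<omega>)) \<partial>distr M N (\<xi> k))"
      using meas by (subst nn_integral_distr) auto
    also have "\<dots> = ennreal (\<integral>s. \<phi> s (x k \<omega>) \<partial>N)"
      unfolding law by (intro nn_integral_eq_integral int x_space \<omega>) (simp add: nonneg)
    also have "\<dots> \<le> ennreal (K (x k \<omega>))"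
      by (intro ennreal_leI le x_space \<omega>)
    finally show "(\<integral>\<^sup>+\<omega>'. \<Phi> (past \<omega>, now \<omega>') \<partial>M) \<le> ennreal (K (x k \<omega>))" .
  qed
  finally have tonelli: "(\<integral>\<^sup>+\<omega>. ennreal (\<phi> (\<xi> k \<omega>) (x k \<omega>)) \<partial>M) \<le> (\<integral>\<^sup>+\<omega>. ennreal (K (x k \<omega>)) \<partial>M)" .
  have K_nonneg: "0 \<le> K (x k \<omega>)" if "\<omega> \<in> space M" for \<omega>
    by (rule order_trans[OF Bochner_Integration.integral_nonneg le[OF x_space[OF that]]])
      (rule nonneg)
  have "(\<integral>\<^sup>+\<omega>. ennreal (K (x k \<omega>)) \<partial>M) = ennreal (\<integral>\<omega>. K (x k \<omega>) \<partial>M)"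
    using K_nonneg by (intro nn_integral_eq_integral K) auto
  with tonelli have main: "(\<integral>\<^sup>+\<omega>. ennreal (\<phi> (\<xi> k \<omega>) (x k \<omega>)) \<partial>M) \<le> ennreal (\<integral>\<omega>. K (x k \<omega>) \<partial>M)"
    by simp
  show \<phi>int: "integrable M (\<lambda>\<omega>. \<phi> (\<xi> k \<omega>) (x k \<omega>))"
    using \<phi>x main by (intro integrableI_nonneg) (auto simp: nonneg intro: le_less_trans)
  have "0 \<le> (\<integral>\<omega>. K (x k \<omega>) \<partial>M)"
    using K_nonneg by (intro integral_nonneg_AE) auto
  then show "(\<integral>\<omega>. \<phi> (\<xi> k \<omega>) (x k \<omega>) \<partial>M) \<le> (\<integral>\<omega>. K (x k \<omega>) \<partial>M)"
    using main nn_integral_eq_integral[OF \<phi>int] by (simp add: nonneg)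
qed

section \<open>Convergence rate and bit count\<close>

text \<open>Telescoping bounds the sum of the \<open>D\<^sub>k\<close> over \<open>k \<le> t\<close>, and by monotonicity the last of these
  \<open>t + 1\<close> terms is at most their average. Having \<open>t + 1\<close> terms after only \<open>t\<close> steps is what makes
  rounding the iteration bound down harmless.\<close>

lemma last_iterate_rate:
  fixes A D :: "nat \<Rightarrow> real"
  assumes A: "\<And>k. A (Suc k) \<le> A k - \<eta> * D k" and nonneg: "\<And>k. 0 \<le> A k"
    and "0 \<le> \<eta>" and D: "\<And>k. D (Suc k) \<le> D k"
  shows "real (Suc t) * (\<eta> * D t) \<le> A 0"
proof -
  have "decseq D"
    using D by (rule decseq_SucI)
  then have "(\<Sum>k<Suc t. \<eta> * D t) \<le> (\<Sum>k<Suc t. \<eta> * D k)"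
    using \<open>0 \<le> \<eta>\<close> by (intro sum_mono mult_left_mono) (auto simp: decseq_def)
  also have "\<dots> \<le> (\<Sum>k<Suc t. A k - A (Suc k))"
    using A by (intro sum_mono) (simp add: le_diff_eq diff_le_eq add.commute)
  also have "\<dots> = A 0 - A (Suc t)"
    by (rule sum_lessThan_telescope')
  finally show ?thesis
    using nonneg[of "Suc t"] by simp
qed

lemma borel_measurable_nnz [measurable]: "(\<lambda>v :: real ^ 'd. real (nnz v)) \<in> borel_measurable borel"
proof -
  have "real (nnz v) = (\<Sum>i\<in>UNIV. of_bool (v $ i \<noteq> 0))" for v :: "real ^ 'd"
    by (simp add: nnz_def supp_def of_nat_sum[symmetric] del: of_nat_sum)
  then show ?thesis
    by (simp only:) measurable
qed

lemma nnz_le_card: "nnz (v :: real ^ 'd) \<le> CARD('d)"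
  unfolding nnz_def by (intro card_mono) auto

text \<open>The objective may be any convex smooth function here: its structure as a sum, and the
  conflicts, enter the rate only through the value of \<open>L\<close>.\<close>

locale quantized_gradient_descent = prob_space M
  for M :: "'w measure" +
  fixes N :: "'s measure" and Q :: "'s \<Rightarrow> real ^ 'd \<Rightarrow> real ^ 'd" and \<alpha> L \<gamma> :: real
    and f :: "real ^ 'd \<Rightarrow> real" and x0 xstar :: "real ^ 'd"
    and \<xi> :: "nat \<Rightarrow> 'w \<Rightarrow> 's" and x :: "nat \<Rightarrow> 'w \<Rightarrow> real ^ 'd"
  assumes f: "convex_smooth L f" and L_pos: "0 < L" and min: "\<And>y. f xstar \<le> f y"
    and Q: "unbiased_quantizer N Q \<alpha>" and \<gamma>: "\<gamma> = 1 / (L * \<alpha>)"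
    and fresh: "fresh_seeds M N \<xi>"
    and init: "\<And>\<omega>. \<omega> \<in> space M \<Longrightarrow> x 0 \<omega> = x0"
    and step: "\<And>k \<omega>. \<omega> \<in> space M \<Longrightarrow> x (Suc k) \<omega> = x k \<omega> - \<gamma> *\<^sub>R Q (\<xi> k \<omega>) (grad f (x k \<omega>))"
begin

definition update :: "'s \<Rightarrow> real ^ 'd \<Rightarrow> real ^ 'd" where
  "update s v = v - \<gamma> *\<^sub>R Q s (grad f v)"

lemma f_measurable [measurable]: "f \<in> borel_measurable borel"
  using convex_smooth_continuous[OF f] by (rule borel_measurable_continuous_onI)

lemma Q_grad_measurable [measurable]:
  "(\<lambda>z. Q (fst z) (grad f (snd z))) \<in> borel_measurable (N \<Otimes>\<^sub>M borel)"
proof -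
  have [measurable]: "grad f \<in> borel_measurable borel"
    using convex_smooth_continuous_grad[OF f L_pos] by (rule borel_measurable_continuous_onI)
  have "(\<lambda>(s, v). Q s v) \<in> borel_measurable (N \<Otimes>\<^sub>M borel)"
    using Q unfolding unbiased_quantizer_def by blast
  from measurable_compose[OF _ this, of "\<lambda>z. (fst z, grad f (snd z))" "N \<Otimes>\<^sub>M borel"]
  show ?thesis
    by simp
qed

lemma update_measurable [measurable]:
  "(\<lambda>z. update (fst z) (snd z)) \<in> borel_measurable (N \<Otimes>\<^sub>M borel)"
  unfolding update_def by measurable

lemma seed_expectation_le:
  fixes \<phi> :: "'s \<Rightarrow> real ^ 'd \<Rightarrow> real" and K :: "real ^ 'd \<Rightarrow> real"
  assumes "(\<lambda>(s, v). \<phi> s v) \<in> borel_measurable (N \<Otimes>\<^sub>M borel)" and "\<And>s v. 0 \<le> \<phi> s v"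
    and "\<And>v. integrable N (\<lambda>s. \<phi> s v)" and "\<And>v. (\<integral>s. \<phi> s v \<partial>N) \<le> K v"
    and "integrable M (\<lambda>\<omega>. K (x k \<omega>))"
  shows "integrable M (\<lambda>\<omega>. \<phi> (\<xi> k \<omega>) (x k \<omega>))"
    and "(\<integral>\<omega>. \<phi> (\<xi> k \<omega>) (x k \<omega>) \<partial>M) \<le> (\<integral>\<omega>. K (x k \<omega>) \<partial>M)"
proof -
  have h: "(\<lambda>(s, v). update s v) \<in> borel_measurable (N \<Otimes>\<^sub>M borel)"
    using update_measurable by (simp add: case_prod_beta)
  have step': "x (Suc k) \<omega> = update (\<xi> k \<omega>) (x k \<omega>)" if "\<omega> \<in> space M" for k \<omega>
    using step[OF that] by (simp add: update_def)
  note * = fresh_seed_expectation_le[where K = K, OF prob_space_axioms fresh h _ init step' assms(1,2)]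
  show "integrable M (\<lambda>\<omega>. \<phi> (\<xi> k \<omega>) (x k \<omega>))"
    by (rule *) (simp_all add: assms)
  show "(\<integral>\<omega>. \<phi> (\<xi> k \<omega>) (x k \<omega>) \<partial>M) \<le> (\<integral>\<omega>. K (x k \<omega>) \<partial>M)"
    by (rule *) (simp_all add: assms)
qed

text \<open>Integrability propagates along the iteration without any growth estimate: the suboptimality is
  nonnegative and its conditional mean is at most its previous value.\<close>

lemma integrable_suboptimality: "integrable M (\<lambda>\<omega>. f (x k \<omega>) - f xstar)"
  and suboptimality_decreasing:
    "(\<integral>\<omega>. f (x (Suc k) \<omega>) - f xstar \<partial>M) \<le> (\<integral>\<omega>. f (x k \<omega>) - f xstar \<partial>M)"
proof -
  have meas: "(\<lambda>(s, v). f (update s v) - f xstar) \<in> borel_measurable (N \<Otimes>\<^sub>M borel)"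
    unfolding case_prod_beta by measurable
  have next_f: "f (update (\<xi> k \<omega>) (x k \<omega>)) = f (x (Suc k) \<omega>)" if "\<omega> \<in> space M" for k \<omega>
    using step[OF that] by (simp add: update_def)
  note one_step = seed_expectation_le[where \<phi> = "\<lambda>s v. f (update s v) - f xstar"
      and K = "\<lambda>v. f v - f xstar", OF meas, unfolded update_def,
      OF _ quantized_step_descent[OF f L_pos min Q \<gamma>], folded update_def]
  have int: "integrable M (\<lambda>\<omega>. f (x k \<omega>) - f xstar)" for k
  proof (induction k)
    case 0
    show ?case
      by (subst Bochner_Integration.integrable_cong[where g = "\<lambda>_. f x0 - f xstar", OF refl])
        (simp_all add: init)
  next
    case (Suc k)
    from one_step(1)[OF _ this] show ?case
      by (simp add: min next_f cong: Bochner_Integration.integrable_cong)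
  qed
  show "integrable M (\<lambda>\<omega>. f (x k \<omega>) - f xstar)"
    by (rule int)
  from one_step(2)[OF _ int[of k]]
  show "(\<integral>\<omega>. f (x (Suc k) \<omega>) - f xstar \<partial>M) \<le> (\<integral>\<omega>. f (x k \<omega>) - f xstar \<partial>M)"
    by (simp add: min next_f cong: Bochner_Integration.integral_cong)
qed

lemma integrable_distance: "integrable M (\<lambda>\<omega>. (norm (x k \<omega> - xstar))\<^sup>2)"
  and distance_step:
    "(\<integral>\<omega>. (norm (x (Suc k) \<omega> - xstar))\<^sup>2 \<partial>M)
       \<le> (\<integral>\<omega>. (norm (x k \<omega> - xstar))\<^sup>2 \<partial>M) - 2 * \<gamma> * (\<integral>\<omega>. f (x k \<omega>) - f xstar \<partial>M)"
proof -
  have meas: "(\<lambda>(s, v). (norm (update s v - xstar))\<^sup>2) \<in> borel_measurable (N \<Otimes>\<^sub>M borel)"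
    unfolding case_prod_beta by measurable
  have next_x: "update (\<xi> k \<omega>) (x k \<omega>) = x (Suc k) \<omega>" if "\<omega> \<in> space M" for k \<omega>
    using step[OF that] by (simp add: update_def)
  note one_step = seed_expectation_le[where \<phi> = "\<lambda>s v. (norm (update s v - xstar))\<^sup>2"
      and K = "\<lambda>v. (norm (v - xstar))\<^sup>2 - 2 * \<gamma> * (f v - f xstar)", OF meas, unfolded update_def,
      OF _ quantized_step_distance[OF f L_pos min Q \<gamma>], folded update_def]
  have int: "integrable M (\<lambda>\<omega>. (norm (x k \<omega> - xstar))\<^sup>2)" for k
  proof (induction k)
    case 0
    show ?case
      by (subst Bochner_Integration.integrable_cong[where g = "\<lambda>_. (norm (x0 - xstar))\<^sup>2", OF refl])
        (simp_all add: init)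
  next
    case (Suc k)
    then have "integrable M (\<lambda>\<omega>. (norm (x k \<omega> - xstar))\<^sup>2 - 2 * \<gamma> * (f (x k \<omega>) - f xstar))"
      by (intro Bochner_Integration.integrable_diff integrable_mult_right integrable_suboptimality)
    from one_step(1)[OF _ this] show ?case
      by (simp add: next_x cong: Bochner_Integration.integrable_cong)
  qed
  show "integrable M (\<lambda>\<omega>. (norm (x k \<omega> - xstar))\<^sup>2)"
    by (rule int)
  have sub: "integrable M (\<lambda>\<omega>. 2 * \<gamma> * (f (x k \<omega>) - f xstar))"
    by (intro integrable_mult_right integrable_suboptimality)
  from one_step(2)[OF _ Bochner_Integration.integrable_diff[OF int sub]]
  have "(\<integral>\<omega>. (norm (x (Suc k) \<omega> - xstar))\<^sup>2 \<partial>M)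
      \<le> (\<integral>\<omega>. (norm (x k \<omega> - xstar))\<^sup>2 - 2 * \<gamma> * (f (x k \<omega>) - f xstar) \<partial>M)"
    by (simp add: next_x cong: Bochner_Integration.integral_cong)
  also have "\<dots> = (\<integral>\<omega>. (norm (x k \<omega> - xstar))\<^sup>2 \<partial>M)
      - (\<integral>\<omega>. 2 * \<gamma> * (f (x k \<omega>) - f xstar) \<partial>M)"
    by (rule Bochner_Integration.integral_diff[OF int sub])
  finally show "(\<integral>\<omega>. (norm (x (Suc k) \<omega> - xstar))\<^sup>2 \<partial>M)
      \<le> (\<integral>\<omega>. (norm (x k \<omega> - xstar))\<^sup>2 \<partial>M) - 2 * \<gamma> * (\<integral>\<omega>. f (x k \<omega>) - f xstar \<partial>M)"
    by (simp only: integral_mult_right_zero)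
qed

lemma suboptimality_rate:
  "real (Suc t) * (\<integral>\<omega>. f (x t \<omega>) - f xstar \<partial>M) \<le> \<alpha> * L / 2 * (norm (x0 - xstar))\<^sup>2"
proof -
  have \<alpha>: "0 < \<alpha>"
    using Q unfolding unbiased_quantizer_def by blast
  let ?A = "\<lambda>k. \<integral>\<omega>. (norm (x k \<omega> - xstar))\<^sup>2 \<partial>M" and ?D = "\<lambda>k. \<integral>\<omega>. f (x k \<omega>) - f xstar \<partial>M"
  have "real (Suc t) * (2 * \<gamma> * ?D t) \<le> ?A 0"
    using \<alpha> L_pos
    by (intro last_iterate_rate[where A = ?A and D = ?D] distance_step suboptimality_decreasing)
      (auto simp: \<gamma>)
  also have "?A 0 = (\<integral>\<omega>. (norm (x0 - xstar))\<^sup>2 \<partial>M)"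
    by (intro Bochner_Integration.integral_cong) (simp_all add: init)
  also have "\<dots> = (norm (x0 - xstar))\<^sup>2"
    by (simp add: prob_space)
  finally have "real (Suc t) * ?D t * (2 * \<gamma>) \<le> (norm (x0 - xstar))\<^sup>2"
    by (simp only: mult_ac)
  moreover have "2 * \<gamma> = 1 / (\<alpha> * L / 2)"
    by (simp add: \<gamma> mult.commute)
  ultimately show ?thesis
    using \<alpha> L_pos by (simp add: pos_divide_le_eq mult.commute del: of_nat_Suc)
qed

lemma expected_nnz_le:
  assumes "\<And>v. (\<integral>s. real (nnz (Q s v)) \<partial>N) \<le> c"
  shows "integrable M (\<lambda>\<omega>. real (nnz (Q (\<xi> k \<omega>) (grad f (x k \<omega>)))))"
    and "(\<integral>\<omega>. real (nnz (Q (\<xi> k \<omega>) (grad f (x k \<omega>)))) \<partial>M) \<le> c"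
proof -
  interpret N: prob_space N
    using Q unfolding unbiased_quantizer_def by blast
  have meas: "(\<lambda>(s, v). real (nnz (Q s (grad f v)))) \<in> borel_measurable (N \<Otimes>\<^sub>M borel)"
    unfolding case_prod_beta by measurable
  have int: "integrable N (\<lambda>s. real (nnz (Q s v)))" for v
  proof (rule N.integrable_const_bound[where B = "real CARD('d)"])
    have "integrable N (\<lambda>s. Q s v)"
      using Q unfolding unbiased_quantizer_def by blast
    from borel_measurable_integrable[OF this]
    show "(\<lambda>s. real (nnz (Q s v))) \<in> borel_measurable N"
      by measurable
  qed (simp add: nnz_le_card)
  note * = seed_expectation_le[where \<phi> = "\<lambda>s v. real (nnz (Q s (grad f v)))" and K = "\<lambda>_. c",
      OF meas _ int assms]
  show "integrable M (\<lambda>\<omega>. real (nnz (Q (\<xi> k \<omega>) (grad f (x k \<omega>)))))"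
    by (rule *) simp_all
  have "(\<integral>\<omega>. real (nnz (Q (\<xi> k \<omega>) (grad f (x k \<omega>)))) \<partial>M) \<le> (\<integral>\<omega>. c \<partial>M)"
    by (rule *) simp_all
  then show "(\<integral>\<omega>. real (nnz (Q (\<xi> k \<omega>) (grad f (x k \<omega>)))) \<partial>M) \<le> c"
    by (simp add: prob_space)
qed

lemma expected_bits_le:
  assumes "\<And>v. (\<integral>s. real (nnz (Q s v)) \<partial>N) \<le> c" and "0 \<le> B"
  shows "(\<integral>\<omega>. (\<Sum>k<T. encoding_bits CARD('d) B (real (nnz (Q (\<xi> k \<omega>) (grad f (x k \<omega>)))))) \<partial>M)
           \<le> real T * encoding_bits CARD('d) B c"
proof -
  have nonneg: "0 \<le> log 2 (real CARD('d)) + B"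
    using \<open>0 \<le> B\<close> by simp
  let ?n = "\<lambda>k \<omega>. real (nnz (Q (\<xi> k \<omega>) (grad f (x k \<omega>))))"
  note n = expected_nnz_le[OF assms(1)]
  have "(\<integral>\<omega>. (\<Sum>k<T. encoding_bits CARD('d) B (?n k \<omega>)) \<partial>M)
      = (\<Sum>k<T. encoding_bits CARD('d) B (\<integral>\<omega>. ?n k \<omega> \<partial>M))"
    unfolding encoding_bits_def
    by (subst Bochner_Integration.integral_sum) (auto intro: n(1))
  also have "\<dots> \<le> (\<Sum>k<T. encoding_bits CARD('d) B c)"
    unfolding encoding_bits_def by (intro sum_mono mult_right_mono n(2) nonneg)
  finally show ?thesis
    by simp
qed

end

theorem corollary4p4:
  fixes m :: nat
    and fi :: "nat \<Rightarrow> real ^ 'd \<Rightarrow> real"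
    and f :: "real ^ 'd \<Rightarrow> real"
    and loss :: "real \<Rightarrow> real \<Rightarrow> real"
    and a :: "nat \<Rightarrow> real ^ 'd"
    and b :: "nat \<Rightarrow> real"
    and L \<Delta> Lbar \<alpha> c B \<epsilon> \<epsilon>0 Tstar Bstar :: real
    and \<gamma> :: "nat \<Rightarrow> real"
    and x0 xstar :: "real ^ 'd"
    and M :: "'w measure"
    and N :: "'s measure"
    and Q :: "'s \<Rightarrow> real ^ 'd \<Rightarrow> real ^ 'd"
    and \<xi> :: "nat \<Rightarrow> 'w \<Rightarrow> 's"
    and x :: "nat \<Rightarrow> 'w \<Rightarrow> real ^ 'd"
  assumes "1 \<le> m" and "0 < L" and "0 < \<epsilon>" and "0 \<le> B"
    and f_def: "\<And>y. f y = (\<Sum>i=1..m. fi i y)"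
    and smooth: "\<And>i. i \<in> {1..m} \<Longrightarrow> convex_smooth L (fi i)"
    and data: "\<And>i y. i \<in> {1..m} \<Longrightarrow> fi i y = loss (a i \<bullet> y) (b i)"
    and sparsity: "\<And>i y. i \<in> {1..m} \<Longrightarrow> supp (grad (fi i) y) = supp (a i)"
    and minimizer: "\<And>y. f xstar \<le> f y"
    and Delta: "\<Delta> = min (conflict_ave m a) (conflict_max m a)"
    and Lbar: "Lbar = L * sqrt (real m * (1 + \<Delta>))"
    and quantizer: "unbiased_quantizer N Q \<alpha>"
    and c: "0 < c" "c \<le> real CARD('d)"
    and sparse_quantizer: "\<And>v. (\<integral>s. real (nnz (Q s v)) \<partial>N) \<le> c"
    and prob: "prob_space M"
    and fresh: "fresh_seeds M N \<xi>"
    and step_size: "\<And>k. \<gamma> k = 1 / (Lbar * \<alpha>)"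
    and init: "\<And>\<omega>. \<omega> \<in> space M \<Longrightarrow> x 0 \<omega> = x0"
    and step: "\<And>k \<omega>. \<omega> \<in> space M \<Longrightarrow>
                 x (Suc k) \<omega> = x k \<omega> - \<gamma> k *\<^sub>R Q (\<xi> k \<omega>) (grad f (x k \<omega>))"
    and eps0: "\<epsilon>0 = (norm (x0 - xstar))\<^sup>2"
    and Tstar: "Tstar = \<alpha> * Lbar / 2 * (\<epsilon>0 / \<epsilon>)"
    and Bstar: "Bstar = (log 2 (real CARD('d)) + B) * c * (\<alpha> * Lbar / 2) * (\<epsilon>0 / \<epsilon>)"
  shows "\<exists>T::nat. real T \<le> Tstar \<and>
           (\<integral>\<omega>. (\<Sum>k<T. encoding_bits CARD('d) B (real (nnz (Q (\<xi> k \<omega>) (grad f (x k \<omega>)))))) \<partial>M)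
             \<le> real T * encoding_bits CARD('d) B c \<and>
           real T * encoding_bits CARD('d) B c \<le> Bstar \<and>
           (\<forall>t\<ge>T. integrable M (\<lambda>\<omega>. f (x t \<omega>) - f xstar) \<and>
                   (\<integral>\<omega>. (f (x t \<omega>) - f xstar) \<partial>M) \<le> \<epsilon>)"
proof -
  have Lbar_pos: "0 < Lbar"
  proof -
    have "0 \<le> \<Delta>"
      unfolding Delta using conflict_max_nonneg[OF \<open>1 \<le> m\<close>, of a] by (simp add: conflict_ave_nonneg)
    then show ?thesis
      unfolding Lbar using \<open>0 < L\<close> \<open>1 \<le> m\<close> by simp
  qed
  have f_eq: "f = (\<lambda>y. \<Sum>i=1..m. fi i y)"
    using f_def by blast
  have f: "convex_smooth Lbar f"
    unfolding Lbar Delta f_eq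
    by (rule sparse_sum_convex_smooth[where loss = "\<lambda>i t. loss t (b i)", OF \<open>1 \<le> m\<close> \<open>0 < L\<close> smooth])
      (auto simp: sparsity data)
  interpret prob_space M by (rule prob)
  interpret quantized_gradient_descent M N Q \<alpha> Lbar "1 / (Lbar * \<alpha>)" f x0 xstar \<xi> x
    by unfold_locales
      (use f Lbar_pos minimizer quantizer fresh init step in \<open>simp_all add: step_size\<close>)
  have \<alpha>: "0 < \<alpha>"
    using quantizer unfolding unbiased_quantizer_def by blast
  have bits: "0 \<le> encoding_bits CARD('d) B c"
    unfolding encoding_bits_def using c \<open>0 \<le> B\<close> by simp
  define T where "T = nat \<lfloor>Tstar\<rfloor>"
  have "0 \<le> Tstar"
    unfolding Tstar eps0 using \<alpha> Lbar_pos \<open>0 < \<epsilon>\<close> by simp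
  (* Rounding down: T may be 0, and the rate for t \<ge> T carries the factor t + 1 > Tstar. *)
  then have T: "real T \<le> Tstar" "Tstar < real (Suc T)"
    unfolding T_def by (simp_all, linarith+)
  have "real T * encoding_bits CARD('d) B c \<le> Tstar * encoding_bits CARD('d) B c"
    using T(1) bits by (rule mult_right_mono)
  also have "\<dots> = Bstar"
    unfolding Bstar Tstar encoding_bits_def by (simp only: mult_ac)
  finally have T_bits: "real T * encoding_bits CARD('d) B c \<le> Bstar" .
  have "(\<integral>\<omega>. (f (x t \<omega>) - f xstar) \<partial>M) \<le> \<epsilon>" if "T \<le> t" for t
  proof -
    have "real (Suc t) * (\<integral>\<omega>. (f (x t \<omega>) - f xstar) \<partial>M) \<le> \<alpha> * Lbar / 2 * \<epsilon>0"
      unfolding eps0 by (rule suboptimality_rate)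
    also have "\<dots> = Tstar * \<epsilon>"
      unfolding Tstar using \<open>0 < \<epsilon>\<close> by simp
    also have "\<dots> \<le> real (Suc t) * \<epsilon>"
      using T(2) that \<open>0 < \<epsilon>\<close> by (intro mult_right_mono) auto
    finally show ?thesis
      by (rule mult_left_le_imp_le) simp
  qed
  with T(1) T_bits expected_bits_le[OF sparse_quantizer \<open>0 \<le> B\<close>] integrable_suboptimality
  show ?thesis
    by blast
qed

end
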